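(* Let $\alpha>0$, let $s>0$ be a step size, and let $f:\mathbb{R}^d\to\mathbb{R}$ be a (Borel measurable) function with a minimizer $x^*$. Given deterministic $x_0,v_0\in\mathbb{R}^d$, let $(x_n,v_n)_{n\ge0}$ be generated by $$\begin{aligned} x_n' &= x_n + s v_n,\\ v_n' &= v_n - (1+s\sqrt{\alpha})^{-1}\left(s\sqrt{\alpha}\,v_n + s g_n\right) - s\sqrt{\alpha}\,v_n',\\ x_{n+1} &= x_n' - \delta_n,\\ v_{n+1} &= v_n' + (1+s\sqrt{\alpha})^{-1}\sqrt{\alpha}\,\delta_n, \end{aligned}$$ where $g_n$ and $\delta_n$ are (potentially dependent) random vectors in $\mathbb{R}^d$ chosen so that at every iteration $n\ge0$ the following condition holds: $$\text{for all } z\in\mathbb{R}^d:\quad f(x_{n+1})-f(z)\le\langle\mathbb{E}_n(g_n),x_n'-z\rangle-\frac{\alpha}{2}\|x_n'-z\|^2-\frac{s^2}{2}\|g_n\|^2 .$$ Set $$L_n = f(x_n)-f(x^* )+\tfrac12\left\|\sqrt{\alpha}(x_n-x^* )+(1+s\sqrt{\alpha})v_n\right\|^2 .$$ Then for all $n\ge0$, $$\mathbb{E}_n(L_{n+1})\le(1+s\sqrt{\alpha})^{-1}L_n .$$ In particular, if $v_0=0$, then for all $n\ge0$, $$\mathbb{E}\left(f(x_n)-f(x^* )\right)\le\left(1+s\sqrt{\alpha}\right)^{-n}\left(f(x_0)-f(x^* )+\frac{\alpha}{2}\|x_0-x^*\|^2\right).$$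
   Context: Here $\|\cdot\|$ and $\langle\cdot,\cdot\rangle$ are the Euclidean norm and inner product on $\mathbb{R}^d$. No strong convexity, convexity or smoothness of $f$ is assumed separately. $\mathbb{E}_n$ denotes the expectation with respect to the randomness introduced in iteration $n$, i.e. the conditional expectation $\mathbb{E}(\cdot\mid\mathcal{F}_n)$, where $\mathcal{F}_n$ is the $\sigma$-algebra of the randomness introduced in iterations $0,\dots,n-1$ (so $\mathcal F_0$ is trivial, $x_n,v_n,x_n'$ are $\mathcal{F}_n$-measurable, and $g_n,\delta_n$ are $\mathcal{F}_{n+1}$-measurable, with $g_n$ integrable so that $\mathbb{E}_n(g_n)$ is defined). In the condition, the expectation appears only in the inner product; $\|g_n\|^2$ is the norm of the actual random sample. The condition holds almost surely (simultaneously for all $z$), and inequalities between random variables hold almost surely. The second line of the iteration is an implicit (linear) equation which uniquely determines $v_n'$, since $1+s\sqrt\alpha>0$. *)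

theory Defs
  imports "HOL-Probability.Probability"
begin

text \<open>
  The library provides conditional expectations only for real-valued functions; for random vectors
  they are taken componentwise.
\<close>

definition vec_cond_exp ::
    "'a measure \<Rightarrow> 'a measure \<Rightarrow> ('a \<Rightarrow> real ^ 'd) \<Rightarrow> 'a \<Rightarrow> real ^ 'd::finite" where
  "vec_cond_exp M G X \<omega> = (\<chi> i. real_cond_exp M G (\<lambda>\<omega>'. X \<omega>' $ i) \<omega>)"

definition lyapunov ::
    "real \<Rightarrow> real \<Rightarrow> (real ^ 'd \<Rightarrow> real) \<Rightarrow> real ^ 'd \<Rightarrow> real ^ 'd \<Rightarrow> real ^ 'd::finite \<Rightarrow> real" where
  "lyapunov \<alpha> s f xstar x v =
     f x - f xstar
     + 1 / 2 * (norm (sqrt \<alpha> *\<^sub>R (x - xstar) + (1 + s * sqrt \<alpha>) *\<^sub>R v))\<^sup>2"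

end

theory Submission
  imports Defs
begin

text \<open>
  Put \<open>k = 1 + s \<surd>\<alpha>\<close>, \<open>a = x'\<^sub>n - x\<^sup>*\<close>, \<open>G = \<E>\<^sub>n g\<^sub>n\<close> and \<open>W\<^sub>n = \<surd>\<alpha> (x\<^sub>n - x\<^sup>*) + k v\<^sub>n\<close>. The correction \<open>\<delta>\<^sub>n\<close>
  cancels in \<open>W\<^sub>n\<^sub>+\<^sub>1\<close>, so \<open>W\<^sub>n = \<surd>\<alpha> a + v\<^sub>n\<close> and \<open>W\<^sub>n\<^sub>+\<^sub>1 = \<surd>\<alpha> a + (v\<^sub>n - s g\<^sub>n) / k\<close>. Averaging the
  condition at \<open>z = x\<^sup>*\<close> (weight \<open>1 - 1/k\<close>) and at \<open>z = x\<^sub>n\<close> (weight \<open>1/k\<close>) and using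
  \<open>\<parallel>v\<^sub>n - s g\<^sub>n\<parallel>\<^sup>2 \<ge> 0\<close> gives the pathwise inequality
  \<open>L\<^sub>n\<^sub>+\<^sub>1 \<le> (L\<^sub>n + s \<langle>G - g\<^sub>n, W\<^sub>n\<rangle>) / k\<close>, whose last term has conditional expectation zero.

  Integrability comes for free, because the condition forces all iterates to be almost surely
  bounded: \<open>z = x\<^sup>*\<close> gives \<open>\<parallel>g\<^sub>n\<parallel>\<^sup>2 \<le> (2/s\<^sup>2) \<langle>G, a\<rangle>\<close>, whose right-hand side is \<open>\<F>\<^sub>n\<close>-measurable, so
  each component of \<open>G\<close> obeys the same bound, whence \<open>\<parallel>G\<parallel> \<le> (2d/s\<^sup>2) \<parallel>a\<parallel>\<close>; and \<open>z = x\<^sub>n\<^sub>+\<^sub>1\<close> gives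
  \<open>\<parallel>\<delta>\<^sub>n\<parallel> \<le> (2/\<alpha>) \<parallel>G\<parallel>\<close>.
\<close>

section \<open>Deterministic algebra of one iteration\<close>

text \<open>In the implicit equation the terms in \<open>v'\<close> combine to
  \<open>(1 + s * q) *\<^sub>R v'\<close>, and writing \<open>v\<close> as
  \<open>inverse (1 + s * q)\<close> times \<open>v + (s * q) *\<^sub>R v\<close> cancels the
  damping term. The coefficient of \<open>\<delta>\<close> in \<open>v1\<close> is such that
  \<open>q *\<^sub>R x1\<close> and \<open>(1 + s * q) *\<^sub>R v1\<close> contain
  \<open>\<delta>\<close> with opposite signs.\<close>

lemma lyapunov_vector_step:
  fixes x v x' v' x1 v1 g \<delta> xstar :: "'b::real_vector" and q s :: real
  assumes k: "1 + s * q \<noteq> 0"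
    and x': "x' = x + s *\<^sub>R v"
    and v': "v' = v - inverse (1 + s * q) *\<^sub>R ((s * q) *\<^sub>R v + s *\<^sub>R g) - (s * q) *\<^sub>R v'"
    and x1: "x1 = x' - \<delta>"
    and v1: "v1 = v' + (inverse (1 + s * q) * q) *\<^sub>R \<delta>"
  shows "q *\<^sub>R (x - xstar) + (1 + s * q) *\<^sub>R v = q *\<^sub>R (x' - xstar) + v"
    and "q *\<^sub>R (x1 - xstar) + (1 + s * q) *\<^sub>R v1
           = q *\<^sub>R (x' - xstar) + inverse (1 + s * q) *\<^sub>R (v - s *\<^sub>R g)"
    and "v' = inverse (1 + s * q) *\<^sub>R inverse (1 + s * q) *\<^sub>R (v - s *\<^sub>R g)"
proof -
  let ?k = "1 + s * q"
  show "q *\<^sub>R (x - xstar) + ?k *\<^sub>R v = q *\<^sub>R (x' - xstar) + v"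
    by (simp add: x' algebra_simps)
  have "v' + (s * q) *\<^sub>R v' = v - inverse ?k *\<^sub>R ((s * q) *\<^sub>R v + s *\<^sub>R g)"
    by (subst v') simp
  also have "\<dots> = inverse ?k *\<^sub>R (v + (s * q) *\<^sub>R v) - inverse ?k *\<^sub>R ((s * q) *\<^sub>R v + s *\<^sub>R g)"
    using k by (simp add: scaleR_left_distrib[of 1 "s * q" v, simplified, symmetric])
  also have "\<dots> = inverse ?k *\<^sub>R (v - s *\<^sub>R g)"
    by (simp flip: scaleR_diff_right)
  finally have kv': "?k *\<^sub>R v' = inverse ?k *\<^sub>R (v - s *\<^sub>R g)"
    by (simp add: scaleR_left_distrib)
  have "?k *\<^sub>R v1 = ?k *\<^sub>R v' + q *\<^sub>R \<delta>"
    using k by (simp add: v1 scaleR_right_distrib field_simps)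
  then show "q *\<^sub>R (x1 - xstar) + ?k *\<^sub>R v1
      = q *\<^sub>R (x' - xstar) + inverse ?k *\<^sub>R (v - s *\<^sub>R g)"
    by (simp add: kv' x1 scaleR_right_diff_distrib)
  have "v' = inverse ?k *\<^sub>R ?k *\<^sub>R v'"
    using k by simp
  then show "v' = inverse ?k *\<^sub>R inverse ?k *\<^sub>R (v - s *\<^sub>R g)"
    by (simp only: kv')
qed

text \<open>With \<open>D = inverse k\<close> one has \<open>D * s * q = 1 - D\<close>, so averaging
  with weights \<open>1 - D\<close> and \<open>D\<close> turns the inner products with
  \<open>G\<close> into \<open>D * s * (G \<bullet> (q *\<^sub>R a + v))\<close>. This is the mean
  part of the error term. Here \<open>G\<close> is an arbitrary vector, so the estimate can be used
  at each sample point.\<close>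

lemma lyapunov_step:
  fixes f :: "real ^ 'd::finite \<Rightarrow> real"
    and x v x' v' x1 v1 g G \<delta> xstar :: "real ^ 'd" and \<alpha> s :: real
  defines "k \<equiv> 1 + s * sqrt \<alpha>"
  assumes \<alpha>: "\<alpha> > 0" and s: "s > 0"
    and x': "x' = x + s *\<^sub>R v"
    and v': "v' = v - inverse k *\<^sub>R ((s * sqrt \<alpha>) *\<^sub>R v + s *\<^sub>R g) - (s * sqrt \<alpha>) *\<^sub>R v'"
    and x1: "x1 = x' - \<delta>"
    and v1: "v1 = v' + (inverse k * sqrt \<alpha>) *\<^sub>R \<delta>"
    and descent: "\<And>z. f x1 - f z \<le> G \<bullet> (x' - z) - \<alpha> / 2 * (norm (x' - z))\<^sup>2 - s\<^sup>2 / 2 * (norm g)\<^sup>2"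
  shows "lyapunov \<alpha> s f xstar x1 v1
    \<le> inverse k * (lyapunov \<alpha> s f xstar x v
        + s * ((sqrt \<alpha> *\<^sub>R (x - xstar) + k *\<^sub>R v) \<bullet> (G - g)))"
proof -
  define q where "q = sqrt \<alpha>"
  define D where "D = inverse k"
  define a where "a = x' - xstar"
  have q: "q > 0" "q\<^sup>2 = \<alpha>"
    using \<alpha> by (auto simp: q_def)
  have k: "k = 1 + s * q" "k > 1"
    using s q by (auto simp: k_def q_def)
  have D: "D > 0" "D < 1" "D * s * q = 1 - D"
    using k by (auto simp: D_def field_simps)
  have W: "sqrt \<alpha> *\<^sub>R (x - xstar) + k *\<^sub>R v = q *\<^sub>R a + v"
    and W1: "sqrt \<alpha> *\<^sub>R (x1 - xstar) + k *\<^sub>R v1 = q *\<^sub>R a + D *\<^sub>R (v - s *\<^sub>R g)"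
    using lyapunov_vector_step(1,2)[OF _ x' v'[unfolded k_def] x1 v1[unfolded k_def], where xstar = xstar] k
    unfolding a_def D_def k_def q_def by auto
  have fstar: "f x1 - f xstar \<le> G \<bullet> a - q\<^sup>2 / 2 * (a \<bullet> a) - s\<^sup>2 / 2 * (g \<bullet> g)"
    using descent[of xstar] by (simp add: a_def q power2_norm_eq_inner)
  have fx: "f x1 - f x \<le> s * (G \<bullet> v) - q\<^sup>2 / 2 * (s\<^sup>2 * (v \<bullet> v)) - s\<^sup>2 / 2 * (g \<bullet> g)"
    using descent[of x] by (simp add: x' q power_mult_distrib flip: power2_norm_eq_inner)
  have avg: "f x1 - f xstar \<le> D * (f x - f xstar)
      + (1 - D) * (G \<bullet> a - q\<^sup>2 / 2 * (a \<bullet> a) - s\<^sup>2 / 2 * (g \<bullet> g))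
      + D * (s * (G \<bullet> v) - q\<^sup>2 / 2 * (s\<^sup>2 * (v \<bullet> v)) - s\<^sup>2 / 2 * (g \<bullet> g))"
    using mult_left_mono[OF fstar, of "1 - D"] mult_left_mono[OF fx, of D] D
    by (simp add: algebra_simps)
  have sq: "0 \<le> (v - s *\<^sub>R g) \<bullet> (v - s *\<^sub>R g)"
    by simp
  \<comment> \<open>This sum is exactly the gap between the claimed bound and the one that
    \<open>avg\<close> gives: all terms containing \<open>a\<close> or \<open>G\<close> cancel, and
    the remaining terms in \<open>v\<close> and \<open>g\<close> are completed to a square.\<close>
  have "D * (1 - D) / 2 * ((v - s *\<^sub>R g) \<bullet> (v - s *\<^sub>R g)) + (1 - D) * s\<^sup>2 / 2 * (g \<bullet> g)
      + D * q\<^sup>2 / 2 * (s\<^sup>2 * (v \<bullet> v)) \<ge> 0"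
    using D sq by simp
  then have slack: "0 \<le> D * (1 - D) / 2 * (v \<bullet> v) - D * (1 - D) * s * (g \<bullet> v)
      + (1 - D) * (1 + D) * s\<^sup>2 / 2 * (g \<bullet> g) + D * q\<^sup>2 / 2 * (s\<^sup>2 * (v \<bullet> v))"
    by (simp add: inner_diff inner_commute algebra_simps power2_eq_square add_divide_distrib diff_divide_distrib)
  have "(norm (q *\<^sub>R a + D *\<^sub>R (v - s *\<^sub>R g)))\<^sup>2
      = q\<^sup>2 * (a \<bullet> a) + 2 * q * D * (a \<bullet> v) - 2 * (D * s * q) * (g \<bullet> a)
        + D\<^sup>2 * (v \<bullet> v) - 2 * D\<^sup>2 * s * (g \<bullet> v) + D\<^sup>2 * s\<^sup>2 * (g \<bullet> g)"
    unfolding power2_norm_eq_inner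
    by (simp add: inner_diff inner_add inner_commute algebra_simps power2_eq_square)
  then have L1: "lyapunov \<alpha> s f xstar x1 v1 = f x1 - f xstar + 1 / 2 *
      (q\<^sup>2 * (a \<bullet> a) + 2 * q * D * (a \<bullet> v) - 2 * (1 - D) * (g \<bullet> a)
        + D\<^sup>2 * (v \<bullet> v) - 2 * D\<^sup>2 * s * (g \<bullet> v) + D\<^sup>2 * s\<^sup>2 * (g \<bullet> g))"
    using W1 D(3) by (simp add: lyapunov_def k_def)
  have "(norm (q *\<^sub>R a + v))\<^sup>2 = q\<^sup>2 * (a \<bullet> a) + 2 * q * (a \<bullet> v) + v \<bullet> v"
    unfolding power2_norm_eq_inner
    by (simp add: inner_add inner_commute algebra_simps power2_eq_square)
  then have L: "lyapunov \<alpha> s f xstar x v = f x - f xstar + 1 / 2 *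
      (q\<^sup>2 * (a \<bullet> a) + 2 * q * (a \<bullet> v) + v \<bullet> v)"
    using W by (simp add: lyapunov_def k_def)
  \<comment> \<open>The relation \<open>D * s * q = 1 - D\<close> is substituted here and in
    \<open>L1\<close>, so that the final comparison is linear in the remaining monomials.\<close>
  have "D * s * ((q *\<^sub>R a + v) \<bullet> (G - g))
      = (D * s * q) * (G \<bullet> a - g \<bullet> a) + D * s * (G \<bullet> v - g \<bullet> v)"
    by (simp add: inner_diff inner_add inner_commute algebra_simps)
  then have noise: "D * s * ((q *\<^sub>R a + v) \<bullet> (G - g))
      = (1 - D) * (G \<bullet> a - g \<bullet> a) + D * s * (G \<bullet> v - g \<bullet> v)"
    by (simp only: D(3))
  have "lyapunov \<alpha> s f xstar x1 v1
      \<le> D * lyapunov \<alpha> s f xstar x v + D * s * ((q *\<^sub>R a + v) \<bullet> (G - g))"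
    using avg slack unfolding L1 L noise
    by (simp add: algebra_simps power2_eq_square add_divide_distrib diff_divide_distrib)
  then show ?thesis
    by (simp only: W D_def distrib_left mult.assoc)
qed

section \<open>Conditional expectations of random vectors\<close>

text \<open>
  The upper bound \<open>Y\<close> need not be integrable; multiplying by the positive weight \<open>1 / (1 + \<bar>Y\<bar>)\<close>
  makes it bounded.
\<close>

lemma (in finite_measure_subalgebra) real_cond_exp_le_measurable:
  assumes X: "integrable M X" and Y [measurable]: "Y \<in> borel_measurable F"
    and le: "AE \<omega> in M. X \<omega> \<le> Y \<omega>"
  shows "AE \<omega> in M. real_cond_exp M F X \<omega> \<le> Y \<omega>"
proof -
  define h where "h \<omega> = inverse (1 + \<bar>Y \<omega>\<bar>)" for \<omega>
  have h: "h \<omega> > 0" "\<bar>h \<omega>\<bar> \<le> 1" "\<bar>h \<omega> * Y \<omega>\<bar> \<le> 1" for \<omega>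
    by (auto simp: h_def abs_mult field_simps)
  have hF [measurable]: "h \<in> borel_measurable F"
    unfolding h_def by measurable
  have XM [measurable]: "X \<in> borel_measurable M"
    using X by simp
  have hM [measurable]: "h \<in> borel_measurable M" and YM [measurable]: "Y \<in> borel_measurable M"
    by (auto intro: measurable_from_subalg[OF subalg])
  have hX: "integrable M (\<lambda>\<omega>. h \<omega> * X \<omega>)"
    by (rule Bochner_Integration.integrable_bound[OF X])
      (auto simp: abs_mult intro!: mult_left_le_one_le h)
  have hY: "integrable M (\<lambda>\<omega>. h \<omega> * Y \<omega>)"
    by (rule integrable_const_bound[where B = 1]) (auto simp: h)
  have "AE \<omega> in M. real_cond_exp M F (\<lambda>\<omega>. h \<omega> * X \<omega>) \<omega> \<le> real_cond_exp M F (\<lambda>\<omega>. h \<omega> * Y \<omega>) \<omega>"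
    using le by (intro real_cond_exp_mono hX hY) (auto simp: h)
  moreover have "AE \<omega> in M. real_cond_exp M F (\<lambda>\<omega>. h \<omega> * X \<omega>) \<omega> = h \<omega> * real_cond_exp M F X \<omega>"
    using hX by (intro real_cond_exp_mult) auto
  moreover have "AE \<omega> in M. real_cond_exp M F (\<lambda>\<omega>. h \<omega> * Y \<omega>) \<omega> = h \<omega> * Y \<omega>"
    by (rule real_cond_exp_F_meas[OF hY]) simp
  ultimately show ?thesis
    by eventually_elim (simp add: h)
qed

lemma integrable_vec_nth:
  fixes X :: "'a \<Rightarrow> real ^ 'd::finite"
  shows "integrable M X \<Longrightarrow> integrable M (\<lambda>\<omega>. X \<omega> $ i)"
  by (rule integrable_bounded_linear[OF bounded_linear_vec_nth])

lemma borel_measurable_vec_nth [measurable (raw)]: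
  fixes X :: "'a \<Rightarrow> real ^ 'd::finite"
  shows "X \<in> borel_measurable M \<Longrightarrow> (\<lambda>\<omega>. X \<omega> $ i) \<in> borel_measurable M"
  by (rule borel_measurable_continuous_on[of "\<lambda>y. y $ i"])
    (auto intro!: continuous_intros)

lemma borel_measurable_inner_vec_cond_exp:
  fixes X W :: "'a \<Rightarrow> real ^ 'd::finite"
  assumes [measurable]: "W \<in> borel_measurable F"
  shows "(\<lambda>\<omega>. vec_cond_exp M F X \<omega> \<bullet> W \<omega>) \<in> borel_measurable F"
  unfolding vec_cond_exp_def inner_vec_def by simp

text \<open>Since \<open>sqrt (Y \<omega>)\<close> dominates each component of \<open>X\<close> and
  its negative, it also dominates the absolute value of the conditional expectation of that
  component. Adding up the squares costs the dimension as a factor, which is harmless where only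
  boundedness matters.\<close>

lemma (in finite_measure_subalgebra) norm_vec_cond_exp_le:
  fixes X :: "'a \<Rightarrow> real ^ 'd::finite"
  assumes X: "integrable M X" and Y [measurable]: "Y \<in> borel_measurable F"
    and le: "AE \<omega> in M. (norm (X \<omega>))\<^sup>2 \<le> Y \<omega>"
  shows "AE \<omega> in M. (norm (vec_cond_exp M F X \<omega>))\<^sup>2 \<le> real CARD('d) * Y \<omega>"
proof -
  have "AE \<omega> in M. (vec_cond_exp M F X \<omega> $ i)\<^sup>2 \<le> Y \<omega>" for i
  proof -
    have int: "integrable M (\<lambda>\<omega>. X \<omega> $ i)"
      using X by (rule integrable_vec_nth)
    have le_i: "AE \<omega> in M. \<bar>X \<omega> $ i\<bar> \<le> sqrt (Y \<omega>)"
      using le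
    proof eventually_elim
      case (elim \<omega>)
      have "\<bar>X \<omega> $ i\<bar> \<le> norm (X \<omega>)"
        by (rule component_le_norm_cart)
      also have "\<dots> \<le> sqrt (Y \<omega>)"
        using elim by (rule real_le_rsqrt)
      finally show ?case .
    qed
    have "AE \<omega> in M. real_cond_exp M F (\<lambda>\<omega>. X \<omega> $ i) \<omega> \<le> sqrt (Y \<omega>)"
      using le_i by (intro real_cond_exp_le_measurable int) auto
    moreover have "AE \<omega> in M. real_cond_exp M F (\<lambda>\<omega>. (-1) * (X \<omega> $ i)) \<omega> \<le> sqrt (Y \<omega>)"
      using le_i int by (intro real_cond_exp_le_measurable) auto
    moreover have "AE \<omega> in M. real_cond_exp M F (\<lambda>\<omega>. (-1) * (X \<omega> $ i)) \<omega>
        = (-1) * real_cond_exp M F (\<lambda>\<omega>. X \<omega> $ i) \<omega>"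
      using int by (rule real_cond_exp_cmult)
    ultimately show ?thesis
      using le
    proof eventually_elim
      case (elim \<omega>)
      have "0 \<le> Y \<omega>"
        using elim(4) by (rule order_trans[rotated]) simp
      moreover have "\<bar>real_cond_exp M F (\<lambda>\<omega>. X \<omega> $ i) \<omega>\<bar> \<le> sqrt (Y \<omega>)"
        using elim by auto
      ultimately show ?case
        using sqrt_ge_absD by (simp add: vec_cond_exp_def)
    qed
  qed
  then have "AE \<omega> in M. \<forall>i. (vec_cond_exp M F X \<omega> $ i)\<^sup>2 \<le> Y \<omega>"
    by (simp add: AE_all_countable)
  then show ?thesis
  proof eventually_elim
    case (elim \<omega>)
    have "(norm (vec_cond_exp M F X \<omega>))\<^sup>2 = (\<Sum>i\<in>UNIV. (vec_cond_exp M F X \<omega> $ i)\<^sup>2)"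
      unfolding power2_norm_eq_inner inner_vec_def by (simp add: power2_eq_square)
    also have "\<dots> \<le> (\<Sum>i\<in>(UNIV :: 'd set). Y \<omega>)"
      by (rule sum_mono) (simp add: elim)
    finally show ?case
      by simp
  qed
qed

text \<open>The pull-out property is applied in each coordinate; the bound on \<open>W\<close> makes
  the products integrable, with \<open>C * X \<omega> $ i\<close> as dominating function. This is
  what removes the error term of the pathwise estimate in conditional mean.\<close>

lemma (in finite_measure_subalgebra) real_cond_exp_inner:
  fixes W X :: "'a \<Rightarrow> real ^ 'd::finite"
  assumes W [measurable]: "W \<in> borel_measurable F" and X: "integrable M X"
    and bounded: "AE \<omega> in M. norm (W \<omega>) \<le> C"
  shows "integrable M (\<lambda>\<omega>. W \<omega> \<bullet> X \<omega>)"
    and "AE \<omega> in M. real_cond_exp M F (\<lambda>\<omega>. W \<omega> \<bullet> X \<omega>) \<omega> = W \<omega> \<bullet> vec_cond_exp M F X \<omega>"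
proof -
  have WM [measurable]: "W \<in> borel_measurable M"
    by (rule measurable_from_subalg[OF subalg W])
  have XM [measurable]: "X \<in> borel_measurable M"
    using X by simp
  have int: "integrable M (\<lambda>\<omega>. W \<omega> $ i * X \<omega> $ i)" for i
  proof (rule Bochner_Integration.integrable_bound)
    show "integrable M (\<lambda>\<omega>. C * (X \<omega> $ i))"
      using integrable_vec_nth[OF X] by simp
    show "AE \<omega> in M. norm (W \<omega> $ i * X \<omega> $ i) \<le> norm (C * X \<omega> $ i)"
      using bounded
    proof eventually_elim
      case (elim \<omega>)
      then have "\<bar>W \<omega> $ i\<bar> \<le> \<bar>C\<bar>"
        using component_le_norm_cart[of "W \<omega>" i] by linarith
      then show ?case
        by (simp add: abs_mult mult_right_mono)
    qed
  qed simp
  then show "integrable M (\<lambda>\<omega>. W \<omega> \<bullet> X \<omega>)"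
    by (simp add: inner_vec_def)
  have "AE \<omega> in M. real_cond_exp M F (\<lambda>\<omega>. W \<omega> $ i * X \<omega> $ i) \<omega>
      = W \<omega> $ i * real_cond_exp M F (\<lambda>\<omega>. X \<omega> $ i) \<omega>" for i
    using int by (intro real_cond_exp_mult) auto
  then have "AE \<omega> in M. \<forall>i. real_cond_exp M F (\<lambda>\<omega>. W \<omega> $ i * X \<omega> $ i) \<omega>
      = W \<omega> $ i * real_cond_exp M F (\<lambda>\<omega>. X \<omega> $ i) \<omega>"
    by (simp add: AE_all_countable)
  moreover have "AE \<omega> in M. real_cond_exp M F (\<lambda>\<omega>. \<Sum>i\<in>UNIV. W \<omega> $ i * X \<omega> $ i) \<omega>
      = (\<Sum>i\<in>UNIV. real_cond_exp M F (\<lambda>\<omega>. W \<omega> $ i * X \<omega> $ i) \<omega>)"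
    using int by (rule real_cond_exp_sum)
  ultimately show "AE \<omega> in M. real_cond_exp M F (\<lambda>\<omega>. W \<omega> \<bullet> X \<omega>) \<omega> = W \<omega> \<bullet> vec_cond_exp M F X \<omega>"
    by eventually_elim (simp add: inner_vec_def vec_cond_exp_def)
qed

section \<open>Pointwise consequences of the descent condition\<close>

text \<open>The first two bounds drop nonnegative terms at \<open>z = xstar\<close>, the second also
  using minimality. At \<open>z = x1\<close> the left-hand side vanishes, and Cauchy-Schwarz bounds
  a quadratic expression in \<open>norm (x' - x1)\<close> by a linear one.\<close>

lemma descent_condition_bounds:
  fixes f :: "'b::real_inner \<Rightarrow> real"
  assumes s: "s > 0" and \<alpha>: "\<alpha> > 0" and min: "\<And>y. f xstar \<le> f y"
    and descent: "\<And>z. f x1 - f z \<le> G \<bullet> (x' - z) - \<alpha> / 2 * (norm (x' - z))\<^sup>2 - s\<^sup>2 / 2 * (norm g)\<^sup>2"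
  shows "f x1 - f xstar \<le> G \<bullet> (x' - xstar)"
    and "(norm g)\<^sup>2 \<le> 2 / s\<^sup>2 * (G \<bullet> (x' - xstar))"
    and "norm (x' - x1) \<le> 2 / \<alpha> * norm G"
proof -
  have "0 \<le> \<alpha> / 2 * (norm (x' - xstar))\<^sup>2"
    using \<alpha> by simp
  with descent[of xstar] have le: "f x1 - f xstar + s\<^sup>2 / 2 * (norm g)\<^sup>2 \<le> G \<bullet> (x' - xstar)"
    by linarith
  have nonneg: "0 \<le> s\<^sup>2 / 2 * (norm g)\<^sup>2"
    by simp
  with le show "f x1 - f xstar \<le> G \<bullet> (x' - xstar)"
    by linarith
  have "s\<^sup>2 / 2 * (norm g)\<^sup>2 \<le> G \<bullet> (x' - xstar)"
    using le min[of x1] by linarith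
  then show "(norm g)\<^sup>2 \<le> 2 / s\<^sup>2 * (G \<bullet> (x' - xstar))"
    using s by (simp add: field_simps)
  have "\<alpha> / 2 * (norm (x' - x1))\<^sup>2 \<le> G \<bullet> (x' - x1)"
    using descent[of x1] nonneg by linarith
  also have "\<dots> \<le> norm G * norm (x' - x1)"
    by (rule norm_cauchy_schwarz)
  finally have "(\<alpha> * norm (x' - x1)) * norm (x' - x1) \<le> (2 * norm G) * norm (x' - x1)"
    by (simp add: power2_eq_square algebra_simps)
  then have "norm (x' - x1) = 0 \<or> \<alpha> * norm (x' - x1) \<le> 2 * norm G"
    using mult_right_le_imp_le[of "\<alpha> * norm (x' - x1)" "norm (x' - x1)" "2 * norm G"] by fastforce
  then show "norm (x' - x1) \<le> 2 / \<alpha> * norm G"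
    using \<alpha> by (auto simp: field_simps)
qed

section \<open>Almost surely bounded random vectors\<close>

text \<open>The bound is existentially quantified, so boundedness passes along the iteration by
  closure rules without tracking constants that grow with \<open>n\<close>. Measurability is kept
  separate.\<close>

definition AE_bounded :: "'a measure \<Rightarrow> ('a \<Rightarrow> 'b::real_normed_vector) \<Rightarrow> bool" where
  "AE_bounded M X \<longleftrightarrow> (\<exists>C. AE \<omega> in M. norm (X \<omega>) \<le> C)"

lemma AE_boundedI: "AE \<omega> in M. norm (X \<omega>) \<le> C \<Longrightarrow> AE_bounded M X"
  by (auto simp: AE_bounded_def)

lemma AE_boundedE:
  assumes "AE_bounded M X"
  obtains C where "C \<ge> 0" "AE \<omega> in M. norm (X \<omega>) \<le> C"
proof -
  from assms obtain C where "AE \<omega> in M. norm (X \<omega>) \<le> C"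
    by (auto simp: AE_bounded_def)
  then have "AE \<omega> in M. norm (X \<omega>) \<le> max C 0"
    by eventually_elim simp
  then show ?thesis
    by (rule that[rotated]) simp
qed

lemma AE_bounded_const: "AE_bounded M (\<lambda>_. c)"
  by (rule AE_boundedI[where C = "norm c"]) simp

lemma AE_bounded_le:
  assumes "AE_bounded M Y" and "AE \<omega> in M. norm (X \<omega>) \<le> c * norm (Y \<omega>)" and "c \<ge> 0"
  shows "AE_bounded M X"
proof -
  obtain C where "AE \<omega> in M. norm (Y \<omega>) \<le> C"
    using assms(1) by (auto simp: AE_bounded_def)
  with assms(2) have "AE \<omega> in M. norm (X \<omega>) \<le> c * C"
    by eventually_elim (use assms(3) in \<open>auto intro: order_trans mult_left_mono\<close>)
  then show ?thesis
    by (rule AE_boundedI)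
qed

text \<open>Equality is asked for on \<open>space M\<close> only, as in the equations of the
  iteration.\<close>

lemma AE_bounded_cong:
  assumes "\<And>\<omega>. \<omega> \<in> space M \<Longrightarrow> X \<omega> = Y \<omega>" and "AE_bounded M Y"
  shows "AE_bounded M X"
  using assms(2) by (rule AE_bounded_le[where c = 1]) (auto simp: assms(1) intro!: AE_I2)

lemma AE_bounded_scaleR: "AE_bounded M X \<Longrightarrow> AE_bounded M (\<lambda>\<omega>. c *\<^sub>R X \<omega>)"
  by (erule AE_bounded_le[where c = "\<bar>c\<bar>"]) auto

lemma AE_bounded_add:
  assumes "AE_bounded M X" and "AE_bounded M Y"
  shows "AE_bounded M (\<lambda>\<omega>. X \<omega> + Y \<omega>)"
proof -
  obtain B where "AE \<omega> in M. norm (X \<omega>) \<le> B"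
    using assms(1) by (auto simp: AE_bounded_def)
  moreover obtain C where "AE \<omega> in M. norm (Y \<omega>) \<le> C"
    using assms(2) by (auto simp: AE_bounded_def)
  ultimately have "AE \<omega> in M. norm (X \<omega> + Y \<omega>) \<le> B + C"
    by eventually_elim (rule norm_triangle_mono)
  then show ?thesis
    by (rule AE_boundedI)
qed

lemma AE_bounded_diff:
  "AE_bounded M X \<Longrightarrow> AE_bounded M Y \<Longrightarrow> AE_bounded M (\<lambda>\<omega>. X \<omega> - Y \<omega>)"
  using AE_bounded_add[of M X "\<lambda>\<omega>. (-1) *\<^sub>R Y \<omega>"] AE_bounded_scaleR[of M Y "-1"] by simp

lemma AE_bounded_inner:
  assumes "AE_bounded M X" and "AE_bounded M Y"
  shows "AE_bounded M (\<lambda>\<omega>. X \<omega> \<bullet> Y \<omega>)"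
proof -
  obtain B where "B \<ge> 0" "AE \<omega> in M. norm (X \<omega>) \<le> B"
    using assms(1) by (rule AE_boundedE)
  from this(2) have "AE \<omega> in M. norm (X \<omega> \<bullet> Y \<omega>) \<le> B * norm (Y \<omega>)"
  proof eventually_elim
    case (elim \<omega>)
    have "norm (X \<omega> \<bullet> Y \<omega>) \<le> norm (X \<omega>) * norm (Y \<omega>)"
      by (simp add: Cauchy_Schwarz_ineq2)
    also have "\<dots> \<le> B * norm (Y \<omega>)"
      using elim by (rule mult_right_mono) simp
    finally show ?case .
  qed
  with assms(2) show ?thesis
    using \<open>B \<ge> 0\<close> by (rule AE_bounded_le)
qed

lemma (in finite_measure) integrable_AE_bounded:
  fixes X :: "'a \<Rightarrow> 'b::{banach, second_countable_topology}"
  shows "X \<in> borel_measurable M \<Longrightarrow> AE_bounded M X \<Longrightarrow> integrable M X"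
  unfolding AE_bounded_def by (auto intro: integrable_const_bound)

theorem theorem5:
  fixes M :: "'a measure" and F :: "nat \<Rightarrow> 'a measure"
    and f :: "real ^ 'd::finite \<Rightarrow> real"
    and xstar x0 v0 :: "real ^ 'd"
    and x v x' v' g \<delta> :: "nat \<Rightarrow> 'a \<Rightarrow> real ^ 'd"
    and \<alpha> s :: real
  assumes "prob_space M"
    and "filtration (space M) F"
    and "\<And>n. subalgebra M (F n)"
    and "sets (F 0) = {{}, space M}"
    and "\<alpha> > 0" and "s > 0"
    and "f \<in> borel_measurable borel"
    and "\<And>y. f xstar \<le> f y"
    and "\<And>n. g n \<in> borel_measurable (F (Suc n))"
    and "\<And>n. \<delta> n \<in> borel_measurable (F (Suc n))"
    and "\<And>n. integrable M (g n)"
    and "\<And>\<omega>. \<omega> \<in> space M \<Longrightarrow> x 0 \<omega> = x0"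
    and "\<And>\<omega>. \<omega> \<in> space M \<Longrightarrow> v 0 \<omega> = v0"
    and "\<And>n \<omega>. \<omega> \<in> space M \<Longrightarrow> x' n \<omega> = x n \<omega> + s *\<^sub>R v n \<omega>"
    and "\<And>n \<omega>. \<omega> \<in> space M \<Longrightarrow>
           v' n \<omega> = v n \<omega>
             - inverse (1 + s * sqrt \<alpha>) *\<^sub>R ((s * sqrt \<alpha>) *\<^sub>R v n \<omega> + s *\<^sub>R g n \<omega>)
             - (s * sqrt \<alpha>) *\<^sub>R v' n \<omega>"
    and "\<And>n \<omega>. \<omega> \<in> space M \<Longrightarrow> x (Suc n) \<omega> = x' n \<omega> - \<delta> n \<omega>"
    and "\<And>n \<omega>. \<omega> \<in> space M \<Longrightarrow>
           v (Suc n) \<omega> = v' n \<omega> + (inverse (1 + s * sqrt \<alpha>) * sqrt \<alpha>) *\<^sub>R \<delta> n \<omega>"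
    and "\<And>n. AE \<omega> in M. \<forall>z.
           f (x (Suc n) \<omega>) - f z
             \<le> vec_cond_exp M (F n) (g n) \<omega> \<bullet> (x' n \<omega> - z)
                - \<alpha> / 2 * (norm (x' n \<omega> - z))\<^sup>2 - s\<^sup>2 / 2 * (norm (g n \<omega>))\<^sup>2"
  shows "(\<forall>n. integrable M (\<lambda>\<omega>. lyapunov \<alpha> s f xstar (x (Suc n) \<omega>) (v (Suc n) \<omega>)) \<and>
            (AE \<omega> in M.
               real_cond_exp M (F n) (\<lambda>\<omega>. lyapunov \<alpha> s f xstar (x (Suc n) \<omega>) (v (Suc n) \<omega>)) \<omega>
                 \<le> inverse (1 + s * sqrt \<alpha>) * lyapunov \<alpha> s f xstar (x n \<omega>) (v n \<omega>))) \<and>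
         (v0 = 0 \<longrightarrow>
            (\<forall>n. integrable M (\<lambda>\<omega>. f (x n \<omega>) - f xstar) \<and>
               (\<integral>\<omega>. f (x n \<omega>) - f xstar \<partial>M)
                 \<le> inverse (1 + s * sqrt \<alpha>) ^ n
                    * (f x0 - f xstar + \<alpha> / 2 * (norm (x0 - xstar))\<^sup>2)))"
proof -
  interpret prob_space M
    by fact
  interpret F: finite_measure_subalgebra M "F n" for n
    by unfold_locales fact
  note space_F = filtration.space_F[OF assms(2)] and sets_F_mono = filtration.sets_F_mono[OF assms(2)]
  have F_Suc: "subalgebra (F (Suc n)) (F n)" for n
    using sets_F_mono[of n "Suc n"] by (simp add: subalgebra_def space_F)
  define k where "k = 1 + s * sqrt \<alpha>"
  define G where "G n = vec_cond_exp M (F n) (g n)" for n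
  define W where "W n \<omega> = sqrt \<alpha> *\<^sub>R (x n \<omega> - xstar) + k *\<^sub>R v n \<omega>" for n \<omega>
  define L where "L n \<omega> = lyapunov \<alpha> s f xstar (x n \<omega>) (v n \<omega>)" for n \<omega>
  have k: "k > 1"
    using assms(5,6) by (simp add: k_def)
  note [measurable] = assms(7,9,10)
  note x' = assms(14) and v' = assms(15) and x_Suc = assms(16) and v_Suc = assms(17)
  note descent = assms(18)[folded G_def]
  \<comment> \<open>The hypothesis gives \<open>v'\<close> only implicitly; the solved form is what
    yields measurability and boundedness of \<open>v (Suc n)\<close>.\<close>
  have v'_explicit: "v' n \<omega> = inverse k *\<^sub>R inverse k *\<^sub>R (v n \<omega> - s *\<^sub>R g n \<omega>)"
    if "\<omega> \<in> space M" for n \<omega>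
    using lyapunov_vector_step(3)[OF _ x' v' x_Suc v_Suc] that k by (auto simp: k_def)

  \<comment> \<open>Adaptedness of the iterates\<close>
  have xv_measurable: "x n \<in> borel_measurable (F n) \<and> v n \<in> borel_measurable (F n)" for n
  proof (induction n)
    case 0
    \<comment> \<open>The iterates are prescribed only on \<open>space M\<close>, so measurability
      is transferred from the explicit formula by \<open>measurable_cong\<close>, here and in the
      induction step.\<close>
    have "x 0 \<in> borel_measurable (F 0) \<longleftrightarrow> (\<lambda>_. x0) \<in> borel_measurable (F 0)"
      and "v 0 \<in> borel_measurable (F 0) \<longleftrightarrow> (\<lambda>_. v0) \<in> borel_measurable (F 0)"
      by (rule measurable_cong; simp add: space_F assms(12,13))+
    then show ?case
      by simp
  next
    case (Suc n)
    then have [measurable]: "x n \<in> borel_measurable (F (Suc n))" "v n \<in> borel_measurable (F (Suc n))"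
      by (auto intro: measurable_from_subalg[OF F_Suc])
    have "x (Suc n) \<in> borel_measurable (F (Suc n))
        \<longleftrightarrow> (\<lambda>\<omega>. x n \<omega> + s *\<^sub>R v n \<omega> - \<delta> n \<omega>) \<in> borel_measurable (F (Suc n))"
      and "v (Suc n) \<in> borel_measurable (F (Suc n))
        \<longleftrightarrow> (\<lambda>\<omega>. inverse k *\<^sub>R inverse k *\<^sub>R (v n \<omega> - s *\<^sub>R g n \<omega>)
              + (inverse k * sqrt \<alpha>) *\<^sub>R \<delta> n \<omega>) \<in> borel_measurable (F (Suc n))"
      by (rule measurable_cong; simp add: space_F x' x_Suc v_Suc v'_explicit k_def)+
    then show ?case
      by simp
  qed
  then have [measurable]: "x n \<in> borel_measurable (F n)" "v n \<in> borel_measurable (F n)" for n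
    by auto
  have [measurable]: "x n \<in> borel_measurable M" "v n \<in> borel_measurable M" for n
    by (rule measurable_from_subalg[OF assms(3)], measurable)+
  have [measurable]: "x' n \<in> borel_measurable (F n)" for n
  proof -
    have "x' n \<in> borel_measurable (F n) \<longleftrightarrow> (\<lambda>\<omega>. x n \<omega> + s *\<^sub>R v n \<omega>) \<in> borel_measurable (F n)"
      by (rule measurable_cong) (simp add: space_F x')
    then show ?thesis
      by simp
  qed
  have W_measurable [measurable]: "W n \<in> borel_measurable (F n)" for n
    unfolding W_def by measurable
  have L_measurable [measurable]: "L n \<in> borel_measurable (F n)" for n
    unfolding L_def lyapunov_def by measurable
  have inner_G_measurable: "(\<lambda>\<omega>. G n \<omega> \<bullet> Z \<omega>) \<in> borel_measurable (F n)"
    if "Z \<in> borel_measurable (F n)" for n Z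
    unfolding G_def using that by (rule borel_measurable_inner_vec_cond_exp)

  \<comment> \<open>Almost sure boundedness of the iterates\<close>
  have bounded_step: "AE_bounded M (x' n) \<and> AE_bounded M (G n) \<and> AE_bounded M (g n) \<and> AE_bounded M (\<delta> n)"
    if "AE_bounded M (x n)" "AE_bounded M (v n)" for n
  proof (intro conjI)
    define a where "a \<omega> = x' n \<omega> - xstar" for \<omega>
    have a_measurable: "a \<in> borel_measurable (F n)"
      unfolding a_def by measurable
    show x'_bd: "AE_bounded M (x' n)"
      by (rule AE_bounded_cong[where Y = "\<lambda>\<omega>. x n \<omega> + s *\<^sub>R v n \<omega>"])
        (simp_all add: x' AE_bounded_add AE_bounded_scaleR that)
    then have a_bd: "AE_bounded M a"
      unfolding a_def by (intro AE_bounded_diff AE_bounded_const)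
    have g_le: "AE \<omega> in M. (norm (g n \<omega>))\<^sup>2 \<le> 2 / s\<^sup>2 * (G n \<omega> \<bullet> a \<omega>)"
      using descent[of n] unfolding a_def
      by eventually_elim (rule descent_condition_bounds[where f = f, OF assms(6,5,8)]; blast)
    \<comment> \<open>The bound on \<open>g n\<close> involves \<open>G n\<close>, which is itself
      the conditional expectation of \<open>g n\<close>. The circle is broken because the square of
      the norm is bounded by an expression linear in \<open>G n\<close>, so one factor
      \<open>norm (G n \<omega>)\<close> can be cancelled.\<close>
    have "AE \<omega> in M. (norm (G n \<omega>))\<^sup>2 \<le> real CARD('d) * (2 / s\<^sup>2 * (G n \<omega> \<bullet> a \<omega>))"
      unfolding G_def
    proof (rule F.norm_vec_cond_exp_le[OF assms(11)])
      show "(\<lambda>\<omega>. 2 / s\<^sup>2 * (vec_cond_exp M (F n) (g n) \<omega> \<bullet> a \<omega>)) \<in> borel_measurable (F n)"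
        by (intro borel_measurable_times borel_measurable_const
            borel_measurable_inner_vec_cond_exp a_measurable)
    qed (use g_le in \<open>simp add: G_def\<close>)
    then have "AE \<omega> in M. norm (G n \<omega>) \<le> real CARD('d) * (2 / s\<^sup>2) * norm (a \<omega>)"
    proof eventually_elim
      case (elim \<omega>)
      also have "real CARD('d) * (2 / s\<^sup>2 * (G n \<omega> \<bullet> a \<omega>))
          \<le> real CARD('d) * (2 / s\<^sup>2 * (norm (G n \<omega>) * norm (a \<omega>)))"
        by (intro mult_left_mono norm_cauchy_schwarz) auto
      finally have "norm (G n \<omega>) * norm (G n \<omega>) \<le> (real CARD('d) * (2 / s\<^sup>2) * norm (a \<omega>)) * norm (G n \<omega>)"
        by (simp add: power2_eq_square mult_ac)
      then have "norm (G n \<omega>) = 0 \<or> norm (G n \<omega>) \<le> real CARD('d) * (2 / s\<^sup>2) * norm (a \<omega>)"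
        using mult_right_le_imp_le[of "norm (G n \<omega>)" "norm (G n \<omega>)"] by fastforce
      then show ?case
        by auto
    qed
    with a_bd show G_bd: "AE_bounded M (G n)"
      by (rule AE_bounded_le) simp
    have "AE_bounded M (\<lambda>\<omega>. G n \<omega> \<bullet> a \<omega>)"
      using G_bd a_bd by (rule AE_bounded_inner)
    then obtain C where "AE \<omega> in M. norm (G n \<omega> \<bullet> a \<omega>) \<le> C"
      by (rule AE_boundedE)
    with g_le have "AE \<omega> in M. norm (g n \<omega>) \<le> sqrt (2 / s\<^sup>2 * C)"
    proof eventually_elim
      case (elim \<omega>)
      note elim(1)
      also have "2 / s\<^sup>2 * (G n \<omega> \<bullet> a \<omega>) \<le> 2 / s\<^sup>2 * C"
        using elim(2) by (intro mult_left_mono) auto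
      finally show ?case
        by (rule real_le_rsqrt)
    qed
    then show "AE_bounded M (g n)"
      by (rule AE_boundedI)
    \<comment> \<open>On \<open>space M\<close>, \<open>\<delta> n\<close> is the difference of
      \<open>x' n\<close> and \<open>x (Suc n)\<close>, to which the condition at
      \<open>z = x (Suc n) \<omega>\<close> applies.\<close>
    have "AE \<omega> in M. norm (\<delta> n \<omega>) \<le> 2 / \<alpha> * norm (G n \<omega>)"
      using descent[of n] AE_space
    proof eventually_elim
      case (elim \<omega>)
      then have "norm (x' n \<omega> - x (Suc n) \<omega>) \<le> 2 / \<alpha> * norm (G n \<omega>)"
        by (intro descent_condition_bounds(3)[where f = f, OF assms(6,5,8)]) blast
      then show ?case
        using elim by (simp add: x_Suc)
    qed
    with G_bd show "AE_bounded M (\<delta> n)"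
      by (rule AE_bounded_le) (use assms(5) in simp)
  qed
  have xv_bounded: "AE_bounded M (x n) \<and> AE_bounded M (v n)" for n
  proof (induction n)
    case 0
    show ?case
      using AE_bounded_cong[of M "x 0" "\<lambda>_. x0"] AE_bounded_cong[of M "v 0" "\<lambda>_. v0"]
      by (simp add: assms(12,13) AE_bounded_const)
  next
    case (Suc n)
    then have bd: "AE_bounded M (x' n)" "AE_bounded M (g n)" "AE_bounded M (\<delta> n)" "AE_bounded M (v n)"
      using bounded_step by auto
    show ?case
    proof
      have "AE_bounded M (\<lambda>\<omega>. x' n \<omega> - \<delta> n \<omega>)"
        using bd by (intro AE_bounded_diff)
      then show "AE_bounded M (x (Suc n))"
        by (rule AE_bounded_cong[rotated]) (rule x_Suc)
      have "AE_bounded M (\<lambda>\<omega>. inverse k *\<^sub>R inverse k *\<^sub>R (v n \<omega> - s *\<^sub>R g n \<omega>)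
          + (inverse k * sqrt \<alpha>) *\<^sub>R \<delta> n \<omega>)"
        using bd by (intro AE_bounded_add AE_bounded_diff AE_bounded_scaleR)
      then show "AE_bounded M (v (Suc n))"
        by (rule AE_bounded_cong[rotated]) (simp add: v_Suc v'_explicit k_def)
    qed
  qed
  have W_bounded: "AE_bounded M (W n)" for n
    unfolding W_def using xv_bounded[of n]
    by (intro AE_bounded_add AE_bounded_diff AE_bounded_scaleR AE_bounded_const) auto

  \<comment> \<open>Integrability of the Lyapunov function\<close>
  have f_bounded: "AE_bounded M (\<lambda>\<omega>. f (x n \<omega>) - f xstar)" for n
  proof (cases n)
    case 0
    then show ?thesis
      using AE_bounded_cong[of M "\<lambda>\<omega>. f (x n \<omega>) - f xstar" "\<lambda>_. f x0 - f xstar"]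
      by (simp add: assms(12) AE_bounded_const)
  next
    case (Suc m)
    \<comment> \<open>As \<open>f\<close> is merely measurable, bounded iterates do not by
      themselves give bounded values of \<open>f\<close>. The upper bound comes from the descent
      condition of the preceding iteration, the lower one from minimality.\<close>
    have "AE \<omega> in M. f (x (Suc m) \<omega>) - f xstar \<le> G m \<omega> \<bullet> (x' m \<omega> - xstar)"
      using descent[of m]
      by eventually_elim (rule descent_condition_bounds(1)[where f = f, OF assms(6,5,8)]; blast)
    then have le: "AE \<omega> in M. norm (f (x (Suc m) \<omega>) - f xstar) \<le> 1 * norm (G m \<omega> \<bullet> (x' m \<omega> - xstar))"
    proof eventually_elim
      case (elim \<omega>)
      then show ?case
        using assms(8)[of "x (Suc m) \<omega>"] by simp
    qed
    have "AE_bounded M (\<lambda>\<omega>. G m \<omega> \<bullet> (x' m \<omega> - xstar))"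
      using bounded_step[of m] xv_bounded[of m]
      by (intro AE_bounded_inner AE_bounded_diff AE_bounded_const) auto
    then show ?thesis
      unfolding Suc using le by (rule AE_bounded_le) simp
  qed
  have f_integrable: "integrable M (\<lambda>\<omega>. f (x n \<omega>) - f xstar)" for n
    by (rule integrable_AE_bounded[OF _ f_bounded]) measurable
  \<comment> \<open>The form with \<open>scaleR\<close> and an inner product matches the closure
    rules for \<open>AE_bounded\<close>.\<close>
  have L_eq: "L n = (\<lambda>\<omega>. f (x n \<omega>) - f xstar + (1 / 2) *\<^sub>R (W n \<omega> \<bullet> W n \<omega>))" for n
    by (simp add: fun_eq_iff L_def W_def lyapunov_def k_def power2_norm_eq_inner)
  have L_integrable: "integrable M (L n)" for n
  proof (rule integrable_AE_bounded)
    show "AE_bounded M (L n)"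
      unfolding L_eq
      by (intro AE_bounded_add AE_bounded_scaleR AE_bounded_inner f_bounded W_bounded)
    show "L n \<in> borel_measurable M"
      by (rule measurable_from_subalg[OF assms(3) L_measurable])
  qed

  \<comment> \<open>Contraction in conditional expectation\<close>
  have L_step: "AE \<omega> in M. real_cond_exp M (F n) (L (Suc n)) \<omega> \<le> inverse k * L n \<omega>" for n
  proof -
    obtain C where "AE \<omega> in M. norm (W n \<omega>) \<le> C"
      using W_bounded by (rule AE_boundedE)
    note Wg = F.real_cond_exp_inner[OF W_measurable assms(11)[of n] this]
    have Wg_integrable: "integrable M (\<lambda>\<omega>. (s / k) * (W n \<omega> \<bullet> g n \<omega>))"
      using Wg(1) by simp
    \<comment> \<open>The sample part of the error is moved to the left, so that \<open>?Y\<close>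
      is measurable with respect to \<open>F n\<close> and bounds the conditional expectation of
      \<open>?X\<close>. The term with \<open>G n\<close> then appears on both sides and
      cancels.\<close>
    let ?X = "\<lambda>\<omega>. L (Suc n) \<omega> + (s / k) * (W n \<omega> \<bullet> g n \<omega>)"
    let ?Y = "\<lambda>\<omega>. inverse k * L n \<omega> + (s / k) * (G n \<omega> \<bullet> W n \<omega>)"
    have "AE \<omega> in M. ?X \<omega> \<le> ?Y \<omega>"
      using descent[of n] AE_space
    proof eventually_elim
      case (elim \<omega>)
      have "L (Suc n) \<omega> \<le> inverse k * (L n \<omega> + s * (W n \<omega> \<bullet> (G n \<omega> - g n \<omega>)))"
        unfolding L_def W_def k_def using elim
        by (intro lyapunov_step[OF assms(5,6) x' v' x_Suc v_Suc]) auto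
      then show ?case
        by (simp add: divide_inverse algebra_simps inner_commute)
    qed
    then have "AE \<omega> in M. real_cond_exp M (F n) ?X \<omega> \<le> ?Y \<omega>"
      by (intro F.real_cond_exp_le_measurable Bochner_Integration.integrable_add L_integrable
          Wg_integrable borel_measurable_add borel_measurable_times borel_measurable_const
          L_measurable inner_G_measurable W_measurable)
    moreover have "AE \<omega> in M. real_cond_exp M (F n) ?X \<omega>
        = real_cond_exp M (F n) (L (Suc n)) \<omega>
          + real_cond_exp M (F n) (\<lambda>\<omega>. (s / k) * (W n \<omega> \<bullet> g n \<omega>)) \<omega>"
      by (rule F.real_cond_exp_add[OF L_integrable Wg_integrable])
    moreover have "AE \<omega> in M. real_cond_exp M (F n) (\<lambda>\<omega>. (s / k) * (W n \<omega> \<bullet> g n \<omega>)) \<omega>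
        = (s / k) * real_cond_exp M (F n) (\<lambda>\<omega>. W n \<omega> \<bullet> g n \<omega>) \<omega>"
      by (rule F.real_cond_exp_cmult[OF Wg(1)])
    ultimately show ?thesis
      using Wg(2) by eventually_elim (simp add: G_def inner_commute)
  qed

  \<comment> \<open>Geometric decay of the expectation\<close>
  have decay: "(\<integral>\<omega>. L n \<omega> \<partial>M) \<le> inverse k ^ n * lyapunov \<alpha> s f xstar x0 v0" for n
  proof (induction n)
    case 0
    have "(\<integral>\<omega>. L 0 \<omega> \<partial>M) = (\<integral>\<omega>. lyapunov \<alpha> s f xstar x0 v0 \<partial>M)"
      by (rule Bochner_Integration.integral_cong) (simp_all add: L_def assms(12,13))
    then show ?case
      by (simp add: prob_space)
  next
    case (Suc n)
    have "(\<integral>\<omega>. L (Suc n) \<omega> \<partial>M) = (\<integral>\<omega>. real_cond_exp M (F n) (L (Suc n)) \<omega> \<partial>M)"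
      by (rule F.real_cond_exp_int(2)[OF L_integrable, symmetric])
    also have "\<dots> \<le> (\<integral>\<omega>. inverse k * L n \<omega> \<partial>M)"
      by (intro integral_mono_AE F.real_cond_exp_int(1) L_integrable integrable_mult_right L_step)
    also have "\<dots> = inverse k * (\<integral>\<omega>. L n \<omega> \<partial>M)"
      by simp
    also have "\<dots> \<le> inverse k * (inverse k ^ n * lyapunov \<alpha> s f xstar x0 v0)"
      using Suc k by (intro mult_left_mono) auto
    finally show ?case
      by simp
  qed
  have "(\<integral>\<omega>. f (x n \<omega>) - f xstar \<partial>M)
      \<le> inverse k ^ n * (f x0 - f xstar + \<alpha> / 2 * (norm (x0 - xstar))\<^sup>2)" if "v0 = 0" for n
  proof -
    \<comment> \<open>The nonnegative square in \<open>L n\<close> is dropped; at time zero,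
      \<open>v0 = 0\<close> reduces that square to the distance term of the claim.\<close>
    have "(\<integral>\<omega>. f (x n \<omega>) - f xstar \<partial>M) \<le> (\<integral>\<omega>. L n \<omega> \<partial>M)"
      by (intro integral_mono f_integrable L_integrable) (simp add: L_eq)
    also note decay[of n]
    also have "lyapunov \<alpha> s f xstar x0 v0 = f x0 - f xstar + \<alpha> / 2 * (norm (x0 - xstar))\<^sup>2"
      using that assms(5) by (simp add: lyapunov_def power_mult_distrib)
    finally show ?thesis .
  qed
  then show ?thesis
    using L_integrable L_step f_integrable unfolding L_def k_def by blast
qed

end
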